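(* Let $\mathcal{G} = (S, S_s, S_e, I, A_c, A_{uc}, T, W)$ be a two-player deterministic game with winning condition $W=(L,\varphi)$, where $\varphi = \varphi_0 \wedge \Box\varphi_1$ with $\varphi_0,\varphi_1$ Boolean formulas built from atoms $p$ and $\bigcirc q$ ($p,q\in AP$), and suppose $\varphi$ is realizable for $\mathcal{G}$. Let $\mathcal{R}: S_s \times (A_c \cup A_{uc}) \to \mathbb{R}_{\ge 0}$ be an (a priori unknown) instantaneous reward function, and evaluate system strategies by the worst-case discounted reward $\bar{J}^{\mathcal{G}}_{\mathcal{R}}(\mu,s) = \inf_{\pi \in R^{\mu}(s)} \sum_{k=0}^{\infty}\gamma^k R_{k+1}(\pi)$ with discount factor $0 \le \gamma < 1$. Consider the following procedure: (1) compute a memoryless maximally permissive strategy $\mu_p$ for the system in $\mathcal{G}$; (2) form the game $\hat{\mathcal{G}}$ obtained from $\mathcal{G}$ by removing every system transition not allowed by $\mu_p$, with trivial winning condition $(L, \mathit{True})$; (3) compute (e.g. by maximin-Q learning, converging to an optimal strategy) a deterministic strategy $\hat{\mu}^*$ of $\hat{\mathcal{G}}$ that maximizes $\bar{J}^{\hat{\mathcal{G}}}_{\mathcal{R}}(\cdot, s)$ for all $s \in I$ against an adversarial environment; (4) map $\hat{\mu}^*$ back to a strategy $\mu^*$ of $\mathcal{G}$. Then $\mu^*$ is a memoryless or finite-memory winning strategy for the system in $\mathcal{G}$ that maximizes $\bar{J}^{\mathcal{G}}_{\mathcal{R}}(\mu, s)$ for all $s \in I$ over all winning strategies $\mu$ for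 the system.
   Context: A two-player game is a tuple $\mathcal{G} = (S, S_s, S_e, I, A_c, A_{uc}, T, W)$ where $S$ is a finite set of states partitioned into system states $S_s$ and environment states $S_e$; $I \subseteq S$ is a set of initial states; $A_c$ (system actions) and $A_{uc}$ (environment actions) are disjoint finite sets; $T : S \times (A_c \cup A_{uc}) \to 2^S$ is the transition function; $A(s)$ is the set of actions available at $s$, with $A(s) \subseteq A_c$ for $s\in S_s$ and $A(s)\subseteq A_{uc}$ for $s \in S_e$. The game is deterministic if $|T(s,a)|\le 1$ always. A run is an infinite sequence $s_0s_1\ldots$ with $s_{i+1}=T(s_i,a_i)$, $a_i \in A(s_i)$. $L : S \to 2^{AP}$ is a labeling function and $\varphi$ an LTL formula; a run is winning for the system iff its word $L(s_0)L(s_1)\ldots$ satisfies $\varphi$. Memoryless strategies for the system are maps $\mu: S_s \to A_c$ (or $2^{A_c}$ if non-deterministic) choosing available actions; finite-memory strategies are tuples $(\mu_m,\rho_m,M)$ with finite memory $M$, initial memory $m_0$, action choice $\mu_m : S_s\times M \to A_c$ (or $2^{A_c}$) and memory update $\rho_m: S\times M\to M$. $R^\mu(s)$ is the set of runs from $s$ in which every system move follows $\mu$ (the environment moves arbitrarily). A strategy is winning if for every $s \in I$ all runs in $R^\mu(s)$ are winning; $\varphi$ is realizable if a winning strategy exists. $\mu_1$ includes $\mu_2$ if $R^{\mu_2}(s)\subseteq R^{\mu_1}(s)$ for all $s\in I$. A maximally permissive strategy is a non-deterministic winning strategy that includes all winning strategies. In the discounted reward, $R_{k+1}(\pi)$ denotes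 the $(k+1)$-th instantaneous reward $\mathcal{R}(s,a)$ collected by the system along run $\pi$.
   Formalization: Every state is assumed to have an available action (no dead ends), and runs record actions as well as states, so inclusion of strategies compares state-action runs; otherwise vacuous wins or parallel actions with different rewards refute the claim. *)

theory Defs
  imports
    Complex_Main
    "HOL-Library.Infinite_Set"
    "HOL-Library.Linear_Temporal_Logic_on_Streams"
begin

section \<open>Linear temporal logic\<close>

datatype 'p ltl =
    True_ltl
  | Atom 'p
  | Not_ltl "'p ltl"
  | And_ltl "'p ltl" "'p ltl"
  | Next_ltl "'p ltl"
  | Until_ltl "'p ltl" "'p ltl"

definition Eventually_ltl :: "'p ltl \<Rightarrow> 'p ltl" where
  "Eventually_ltl f = Until_ltl True_ltl f"

definition Always_ltl :: "'p ltl \<Rightarrow> 'p ltl" where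
  "Always_ltl f = Not_ltl (Eventually_ltl (Not_ltl f))"

(* The until of the library is the weak one; LTL uses the strong one. *)
primrec sat :: "'p ltl \<Rightarrow> 'p set stream \<Rightarrow> bool" where
  "sat True_ltl = (\<lambda>w. True)"
| "sat (Atom p) = holds (\<lambda>X. p \<in> X)"
| "sat (Not_ltl f) = not (sat f)"
| "sat (And_ltl f g) = (sat f aand sat g)"
| "sat (Next_ltl f) = nxt (sat f)"
| "sat (Until_ltl f g) = (sat f suntil sat g)"

lemma sat_Eventually_ltl: "sat (Eventually_ltl f) w \<longleftrightarrow> ev (sat f) w"
proof
  assume "sat (Eventually_ltl f) w"
  then have "((\<lambda>w. True) suntil sat f) w"
    by (simp add: Eventually_ltl_def)
  then show "ev (sat f) w"
    by (induction rule: suntil.induct) (auto intro: ev.intros)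
next
  assume "ev (sat f) w"
  then have "((\<lambda>w. True) suntil sat f) w"
    by (induction rule: ev.induct) (auto intro: suntil.intros)
  then show "sat (Eventually_ltl f) w"
    by (simp add: Eventually_ltl_def)
qed

lemma sat_Always_ltl: "sat (Always_ltl f) w \<longleftrightarrow> alw (sat f) w"
  by (simp add: Always_ltl_def sat_Eventually_ltl not_ev_not)

(* Boolean combinations of atoms p and of formulas "next q" with q an atom;
   disjunction and implication are expressed by negation and conjunction. *)
inductive bool_next :: "'p ltl \<Rightarrow> bool" where
  "bool_next True_ltl"
| "bool_next (Atom p)"
| "bool_next (Next_ltl (Atom q))"
| "bool_next f \<Longrightarrow> bool_next (Not_ltl f)"
| "bool_next f \<Longrightarrow> bool_next g \<Longrightarrow> bool_next (And_ltl f g)"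


section \<open>Two-player games\<close>

record ('s, 'a, 'p) game =
  states :: "'s set"
  sys_states :: "'s set"
  env_states :: "'s set"
  init_states :: "'s set"
  sys_actions :: "'a set"
  env_actions :: "'a set"
  trans :: "'s \<Rightarrow> 'a \<Rightarrow> 's set"
  label :: "'s \<Rightarrow> 'p set"
  spec :: "'p ltl"

definition avail :: "('s, 'a, 'p) game \<Rightarrow> 's \<Rightarrow> 'a set" where
  "avail G s = {a \<in> sys_actions G \<union> env_actions G. trans G s a \<noteq> {}}"

(* The last conjunct excludes dead ends. Without it a system strategy could win
   vacuously, and with worst-case reward an infimum over the empty set, by
   steering every play into a state from which there is no infinite run. *)
definition two_player_game :: "('s, 'a, 'p) game \<Rightarrow> bool" where
  "two_player_game G \<longleftrightarrow>
     finite (states G) \<and>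
     sys_states G \<union> env_states G = states G \<and>
     sys_states G \<inter> env_states G = {} \<and>
     init_states G \<subseteq> states G \<and>
     finite (sys_actions G) \<and> finite (env_actions G) \<and>
     sys_actions G \<inter> env_actions G = {} \<and>
     (\<forall>s\<in>states G. \<forall>a\<in>sys_actions G \<union> env_actions G. trans G s a \<subseteq> states G) \<and>
     (\<forall>s\<in>sys_states G. avail G s \<subseteq> sys_actions G) \<and>
     (\<forall>s\<in>env_states G. avail G s \<subseteq> env_actions G) \<and>
     (\<forall>s\<in>states G. avail G s \<noteq> {})"

definition deterministic_game :: "('s, 'a, 'p) game \<Rightarrow> bool" where
  "deterministic_game G \<longleftrightarrow>
     (\<forall>s\<in>states G. \<forall>a\<in>sys_actions G \<union> env_actions G. card (trans G s a) \<le> 1)"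

(* A run records the action taken along with each state. The reward depends on
   the action, and distinct actions may lead to the same successor, so the
   reward is not a function of the state sequence alone. *)
definition is_run :: "('s, 'a, 'p) game \<Rightarrow> ('s \<times> 'a) stream \<Rightarrow> bool" where
  "is_run G \<pi> \<longleftrightarrow>
     (\<forall>i. fst (\<pi> !! i) \<in> states G \<and>
          snd (\<pi> !! i) \<in> avail G (fst (\<pi> !! i)) \<and>
          fst (\<pi> !! Suc i) \<in> trans G (fst (\<pi> !! i)) (snd (\<pi> !! i)))"

definition winning_run :: "('s, 'a, 'p) game \<Rightarrow> ('s \<times> 'a) stream \<Rightarrow> bool" where
  "winning_run G \<pi> \<longleftrightarrow> sat (spec G) (smap (\<lambda>(s, a). label G s) \<pi>)"


section \<open>System strategies\<close>

(* Strategies choose sets of actions; a deterministic strategy is one whose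
   choices are singletons. In Finite_Memory f u M m0, f is the action choice,
   u the memory update, M the memory and m0 the initial memory. Every finite
   memory can be encoded by natural numbers, so quantifying over this type
   covers all finite-memory strategies. *)
datatype ('s, 'a) strategy =
    Memoryless "'s \<Rightarrow> 'a set"
  | Finite_Memory "'s \<Rightarrow> nat \<Rightarrow> 'a set" "'s \<Rightarrow> nat \<Rightarrow> nat" "nat set" nat

primrec choice :: "('s, 'a) strategy \<Rightarrow> 's \<Rightarrow> nat \<Rightarrow> 'a set" where
  "choice (Memoryless f) = (\<lambda>s m. f s)"
| "choice (Finite_Memory f u M m0) = f"

primrec update :: "('s, 'a) strategy \<Rightarrow> 's \<Rightarrow> nat \<Rightarrow> nat" where
  "update (Memoryless f) = (\<lambda>s m. m)"
| "update (Finite_Memory f u M m0) = u"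

primrec memory :: "('s, 'a) strategy \<Rightarrow> nat set" where
  "memory (Memoryless f) = {0}"
| "memory (Finite_Memory f u M m0) = M"

primrec initial_memory :: "('s, 'a) strategy \<Rightarrow> nat" where
  "initial_memory (Memoryless f) = 0"
| "initial_memory (Finite_Memory f u M m0) = m0"

definition is_strategy :: "('s, 'a, 'p) game \<Rightarrow> ('s, 'a) strategy \<Rightarrow> bool" where
  "is_strategy G \<mu> \<longleftrightarrow>
     finite (memory \<mu>) \<and> initial_memory \<mu> \<in> memory \<mu> \<and>
     (\<forall>s\<in>states G. \<forall>m\<in>memory \<mu>. update \<mu> s m \<in> memory \<mu>) \<and>
     (\<forall>s\<in>sys_states G. \<forall>m\<in>memory \<mu>. choice \<mu> s m \<noteq> {} \<and> choice \<mu> s m \<subseteq> avail G s)"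

definition deterministic_strategy :: "('s, 'a, 'p) game \<Rightarrow> ('s, 'a) strategy \<Rightarrow> bool" where
  "deterministic_strategy G \<mu> \<longleftrightarrow>
     (\<forall>s\<in>sys_states G. \<forall>m\<in>memory \<mu>. \<exists>a. choice \<mu> s m = {a})"

primrec memory_at :: "('s, 'a) strategy \<Rightarrow> ('s \<times> 'a) stream \<Rightarrow> nat \<Rightarrow> nat" where
  "memory_at \<mu> \<pi> 0 = initial_memory \<mu>"
| "memory_at \<mu> \<pi> (Suc i) = update \<mu> (fst (\<pi> !! i)) (memory_at \<mu> \<pi> i)"

definition runs_from ::
  "('s, 'a, 'p) game \<Rightarrow> ('s, 'a) strategy \<Rightarrow> 's \<Rightarrow> ('s \<times> 'a) stream set" where
  "runs_from G \<mu> s =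
     {\<pi>. is_run G \<pi> \<and> fst (\<pi> !! 0) = s \<and>
         (\<forall>i. fst (\<pi> !! i) \<in> sys_states G \<longrightarrow>
              snd (\<pi> !! i) \<in> choice \<mu> (fst (\<pi> !! i)) (memory_at \<mu> \<pi> i))}"

definition winning_strategy :: "('s, 'a, 'p) game \<Rightarrow> ('s, 'a) strategy \<Rightarrow> bool" where
  "winning_strategy G \<mu> \<longleftrightarrow>
     is_strategy G \<mu> \<and> (\<forall>s\<in>init_states G. \<forall>\<pi>\<in>runs_from G \<mu> s. winning_run G \<pi>)"

definition realizable :: "('s, 'a, 'p) game \<Rightarrow> bool" where
  "realizable G \<longleftrightarrow> (\<exists>\<mu>. winning_strategy G \<mu>)"

definition includes_strategy ::
  "('s, 'a, 'p) game \<Rightarrow> ('s, 'a) strategy \<Rightarrow> ('s, 'a) strategy \<Rightarrow> bool" where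
  "includes_strategy G \<mu>1 \<mu>2 \<longleftrightarrow>
     (\<forall>s\<in>init_states G. runs_from G \<mu>2 s \<subseteq> runs_from G \<mu>1 s)"

definition maximally_permissive :: "('s, 'a, 'p) game \<Rightarrow> ('s, 'a) strategy \<Rightarrow> bool" where
  "maximally_permissive G \<mu> \<longleftrightarrow>
     winning_strategy G \<mu> \<and> (\<forall>\<nu>. winning_strategy G \<nu> \<longrightarrow> includes_strategy G \<mu> \<nu>)"

definition restrict_game ::
  "('s, 'a, 'p) game \<Rightarrow> ('s \<Rightarrow> 'a set) \<Rightarrow> ('s, 'a, 'p) game" where
  "restrict_game G f =
     G\<lparr>trans := (\<lambda>s a. if s \<in> sys_states G \<and> a \<notin> f s then {} else trans G s a),
       spec := True_ltl\<rparr>"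


section \<open>Discounted reward\<close>

definition sys_positions :: "('s, 'a, 'p) game \<Rightarrow> ('s \<times> 'a) stream \<Rightarrow> nat set" where
  "sys_positions G \<pi> = {i. fst (\<pi> !! i) \<in> sys_states G}"

(* nth_reward G R \<pi> k is the (k+1)-th reward collected by the system, that is, the
   reward of its (k+1)-th move along \<pi>; it is 0 if the system moves at most k times. *)
definition nth_reward ::
  "('s, 'a, 'p) game \<Rightarrow> ('s \<Rightarrow> 'a \<Rightarrow> real) \<Rightarrow> ('s \<times> 'a) stream \<Rightarrow> nat \<Rightarrow> real" where
  "nth_reward G R \<pi> k =
     (if infinite (sys_positions G \<pi>) \<or> k < card (sys_positions G \<pi>)
      then (case \<pi> !! enumerate (sys_positions G \<pi>) k of (s, a) \<Rightarrow> R s a)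
      else 0)"

definition worst_case_reward ::
  "('s, 'a, 'p) game \<Rightarrow> ('s \<Rightarrow> 'a \<Rightarrow> real) \<Rightarrow> real \<Rightarrow> ('s, 'a) strategy \<Rightarrow> 's \<Rightarrow> real" where
  "worst_case_reward G R \<gamma> \<mu> s =
     (INF \<pi>\<in>runs_from G \<mu> s. \<Sum>k. \<gamma> ^ k * nth_reward G R \<pi> k)"

end

theory Submission
  imports Defs
begin

text \<open>
  A strategy of the restricted game has the same runs in both games, and these are runs of the
  maximally permissive strategy; hence it wins. Conversely, a winning strategy of the original game
  can leave the restriction only at pairs of a state and a memory value that no play from an initial
  state reaches, since every finite play consistent with a strategy extends to a run and all
  runs are included in those of the maximally permissive strategy. Redirecting the strategy at
  such pairs gives a strategy of the restricted game with the same runs from the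
  initial states, hence the same worst-case reward.
\<close>

lemma restrict_game_simps [simp]:
  "states (restrict_game G f) = states G"
  "sys_states (restrict_game G f) = sys_states G"
  "init_states (restrict_game G f) = init_states G"
  by (simp_all add: restrict_game_def)

lemma avail_restrict_game:
  "avail (restrict_game G f) s = {a \<in> avail G s. s \<in> sys_states G \<longrightarrow> a \<in> f s}"
  by (auto simp: avail_def restrict_game_def)

lemma trans_restrict_game:
  "trans (restrict_game G f) s a = (if s \<in> sys_states G \<and> a \<notin> f s then {} else trans G s a)"
  by (simp add: restrict_game_def)

lemma runs_from_restrict_game:
  "runs_from (restrict_game G f) \<mu> s =
     {\<pi> \<in> runs_from G \<mu> s. \<forall>i. fst (\<pi> !! i) \<in> sys_states G \<longrightarrow> snd (\<pi> !! i) \<in> f (fst (\<pi> !! i))}"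
  unfolding runs_from_def is_run_def
  by (auto simp: avail_restrict_game trans_restrict_game split: if_splits)

text \<open>Restriction keeps the system states, and these are all that \<open>nth_reward\<close>
  takes from the game; so the two games differ only in the runs over which the infimum
  ranges.\<close>

lemma worst_case_reward_restrict_game:
  "worst_case_reward (restrict_game G f) R \<gamma> \<mu> s =
     (INF \<pi>\<in>runs_from (restrict_game G f) \<mu> s. \<Sum>k. \<gamma> ^ k * nth_reward G R \<pi> k)"
proof -
  have "nth_reward (restrict_game G f) R = nth_reward G R"
    by (intro ext) (simp add: nth_reward_def sys_positions_def)
  then show ?thesis
    by (simp add: worst_case_reward_def)
qed

lemma runs_from_choice:
  assumes "\<pi> \<in> runs_from G \<mu> s" and "fst (\<pi> !! i) \<in> sys_states G"
  shows "snd (\<pi> !! i) \<in> choice \<mu> (fst (\<pi> !! i)) (memory_at \<mu> \<pi> i)"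
  using assms by (simp add: runs_from_def)

text \<open>The memory at \<open>i\<close> is computed from the states before \<open>i\<close>
  alone. Assuming no more than that makes the lemma usable for finite plays as well as for
  runs.\<close>

lemma memory_at_in_memory:
  assumes "is_strategy G \<mu>" and "\<And>j. j < i \<Longrightarrow> fst (\<pi> !! j) \<in> states G"
  shows "memory_at \<mu> \<pi> i \<in> memory \<mu>"
  using assms(2)
proof (induction i)
  case 0
  then show ?case using assms(1) by (simp add: is_strategy_def)
next
  case (Suc i)
  then show ?case using assms(1) by (simp add: is_strategy_def)
qed

lemma is_strategy_of_restrict_game:
  assumes "is_strategy (restrict_game G f) \<mu>"
  shows "is_strategy G \<mu>"
  using assms unfolding is_strategy_def by (fastforce simp: avail_restrict_game)

text \<open>Along a run the memory never leaves \<open>memory \<mu>\<close>, and on that set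
  \<open>is_strategy\<close> confines the choices of \<open>\<mu>\<close> to actions available after
  the restriction, hence to \<open>f\<close>.\<close>

lemma runs_from_restrict_game_strategy:
  assumes "is_strategy (restrict_game G f) \<mu>"
  shows "runs_from (restrict_game G f) \<mu> s = runs_from G \<mu> s"
proof -
  have "snd (\<pi> !! i) \<in> f (fst (\<pi> !! i))"
    if \<pi>: "\<pi> \<in> runs_from G \<mu> s" and sys: "fst (\<pi> !! i) \<in> sys_states G" for \<pi> i
  proof -
    have "memory_at \<mu> \<pi> i \<in> memory \<mu>"
      using memory_at_in_memory[OF assms] \<pi> by (simp add: runs_from_def is_run_def)
    then have "choice \<mu> (fst (\<pi> !! i)) (memory_at \<mu> \<pi> i) \<subseteq> avail (restrict_game G f) (fst (\<pi> !! i))"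
      using assms sys by (simp add: is_strategy_def)
    then show ?thesis
      using \<pi> sys by (auto simp: runs_from_def avail_restrict_game)
  qed
  then show ?thesis
    by (auto simp: runs_from_restrict_game)
qed

text \<open>A play never gets stuck: system choices are nonempty and the game has no dead ends. The
  action of \<open>\<pi>\<close> at \<open>i\<close> itself is unconstrained, so
  \<open>\<pi>'\<close> shares with \<open>\<pi>\<close> only the state and the memory
  there.\<close>

lemma finite_play_extends:
  fixes G :: "('s, 'a, 'p) game"
  assumes G: "two_player_game G" and \<mu>: "is_strategy G \<mu>"
    and states: "\<And>j. j \<le> i \<Longrightarrow> fst (\<pi> !! j) \<in> states G"
    and avail: "\<And>j. j < i \<Longrightarrow> snd (\<pi> !! j) \<in> avail G (fst (\<pi> !! j))"
    and trans: "\<And>j. j < i \<Longrightarrow> fst (\<pi> !! Suc j) \<in> trans G (fst (\<pi> !! j)) (snd (\<pi> !! j))"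
    and choice: "\<And>j. j < i \<Longrightarrow> fst (\<pi> !! j) \<in> sys_states G \<Longrightarrow>
                   snd (\<pi> !! j) \<in> choice \<mu> (fst (\<pi> !! j)) (memory_at \<mu> \<pi> j)"
  obtains \<pi>' where "\<pi>' \<in> runs_from G \<mu> (fst (\<pi> !! 0))"
    and "fst (\<pi>' !! i) = fst (\<pi> !! i)" and "memory_at \<mu> \<pi>' i = memory_at \<mu> \<pi> i"
proof -
  \<comment> \<open>The memory is carried along with state and action, so that whether a move is
    admissible, and what may follow it, depends on the current triple only, as dependent choice
    requires.\<close>
  define valid :: "('s \<times> 'a) \<times> nat \<Rightarrow> bool" where
    "valid = (\<lambda>((s, a), m). s \<in> states G \<and> m \<in> memory \<mu> \<and> a \<in> avail G s \<and>
                (s \<in> sys_states G \<longrightarrow> a \<in> choice \<mu> s m))"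
  \<comment> \<open>State and memory are copied from \<open>\<pi>\<close> up to and including
    \<open>i\<close>, the action only strictly before \<open>i\<close>; at \<open>i\<close> a fresh
    admissible action is picked.\<close>
  define P :: "nat \<Rightarrow> ('s \<times> 'a) \<times> nat \<Rightarrow> bool" where
    "P n x \<longleftrightarrow> valid x \<and> (n \<le> i \<longrightarrow> fst (fst x) = fst (\<pi> !! n) \<and> snd x = memory_at \<mu> \<pi> n) \<and>
       (n < i \<longrightarrow> fst x = \<pi> !! n)" for n x
  define Q :: "nat \<Rightarrow> ('s \<times> 'a) \<times> nat \<Rightarrow> ('s \<times> 'a) \<times> nat \<Rightarrow> bool" where
    "Q n x y \<longleftrightarrow> fst (fst y) \<in> trans G (fst (fst x)) (snd (fst x)) \<and>
       snd y = update \<mu> (fst (fst x)) (snd x)" for n x y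
  have action: "\<exists>a. valid ((s, a), m)" if "s \<in> states G" "m \<in> memory \<mu>" for s m
  proof (cases "s \<in> sys_states G")
    case True
    then have "choice \<mu> s m \<noteq> {}" "choice \<mu> s m \<subseteq> avail G s"
      using \<mu> that by (auto simp: is_strategy_def)
    then show ?thesis using that by (auto simp: valid_def)
  next
    case False
    then show ?thesis using G that by (auto simp: valid_def two_player_game_def)
  qed
  have mem: "memory_at \<mu> \<pi> n \<in> memory \<mu>" if "n \<le> i" for n
    using memory_at_in_memory[OF \<mu>] states that by simp
  have play: "\<exists>a. P n ((fst (\<pi> !! n), a), memory_at \<mu> \<pi> n)" if "n \<le> i" for n
  proof (cases "n < i")
    case True
    then have "P n (\<pi> !! n, memory_at \<mu> \<pi> n)"
      using states avail choice mem by (simp add: P_def valid_def case_prod_beta)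
    then show ?thesis by (auto intro: exI[of _ "snd (\<pi> !! n)"])
  next
    case False
    then show ?thesis using action[OF states mem] that by (auto simp: P_def)
  qed
  have "\<exists>y. P (Suc n) y \<and> Q n x y" if x: "P n x" for n x
  proof (cases "n < i")
    case True
    then have "x = (\<pi> !! n, memory_at \<mu> \<pi> n)"
      using x by (auto simp: P_def prod_eq_iff)
    then show ?thesis
      using play[of "Suc n"] trans True by (auto simp: Q_def)
  next
    case False
    \<comment> \<open>From time \<open>i\<close> on, \<open>P (Suc n)\<close> asks for nothing but
      validity, so any successor with any admissible action will do.\<close>
    obtain s a m where eq: "x = ((s, a), m)" by (metis prod.collapse)
    then have s: "s \<in> states G" "m \<in> memory \<mu>" "a \<in> avail G s"
      using x by (auto simp: P_def valid_def)
    then have "trans G s a \<noteq> {}" "trans G s a \<subseteq> states G"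
      using G by (simp_all add: avail_def two_player_game_def)
    then obtain t where t: "t \<in> trans G s a" "t \<in> states G"
      by blast
    have "update \<mu> s m \<in> memory \<mu>"
      using \<mu> s by (simp add: is_strategy_def)
    then obtain b where "valid ((t, b), update \<mu> s m)"
      using action t by blast
    then have "P (Suc n) ((t, b), update \<mu> s m) \<and> Q n x ((t, b), update \<mu> s m)"
      using t eq False by (simp add: P_def Q_def)
    then show ?thesis by blast
  qed
  moreover have "\<exists>x. P 0 x" using play[of 0] by blast
  ultimately obtain c where P: "\<And>n. P n (c n)" and Q: "\<And>n. Q n (c n) (c (Suc n))"
    using dependent_nat_choice[of P Q] by blast
  define \<pi>' where "\<pi>' = smap (\<lambda>n. fst (c n)) (fromN 0)"
  have nth: "\<pi>' !! n = fst (c n)" for n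
    by (simp add: \<pi>'_def)
  have mem': "memory_at \<mu> \<pi>' n = snd (c n)" for n
  proof (induction n)
    case 0
    then show ?case using P[of 0] by (simp add: P_def)
  next
    case (Suc n)
    then show ?case using Q[of n] by (simp add: Q_def nth)
  qed
  show thesis
  proof
    have "valid (\<pi>' !! n, memory_at \<mu> \<pi>' n)" for n
      using P[of n] by (simp add: P_def nth mem')
    moreover have "fst (\<pi>' !! Suc n) \<in> trans G (fst (\<pi>' !! n)) (snd (\<pi>' !! n))" for n
      using Q[of n] unfolding nth Q_def by blast
    moreover have "fst (\<pi>' !! 0) = fst (\<pi> !! 0)"
      using P[of 0] unfolding nth P_def by simp
    ultimately show "\<pi>' \<in> runs_from G \<mu> (fst (\<pi> !! 0))"
      by (simp add: runs_from_def is_run_def valid_def case_prod_beta)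
    show "fst (\<pi>' !! i) = fst (\<pi> !! i)" "memory_at \<mu> \<pi>' i = memory_at \<mu> \<pi> i"
      using P[of i] unfolding nth mem' P_def by simp_all
  qed
qed

text \<open>The fallback to \<open>f s\<close> keeps the choice nonempty when \<open>\<nu>\<close>
  offers nothing inside \<open>f\<close>. Memory and update are those of \<open>\<nu>\<close>, so
  both strategies remember the same along every sequence.\<close>

definition redirect ::
  "('s \<Rightarrow> 'a set) \<Rightarrow> ('s, 'a) strategy \<Rightarrow> ('s, 'a) strategy" where
  "redirect f \<nu> = Finite_Memory
     (\<lambda>s m. if choice \<nu> s m \<inter> f s = {} then f s else choice \<nu> s m \<inter> f s)
     (update \<nu>) (memory \<nu>) (initial_memory \<nu>)"

lemma memory_at_redirect [simp]: "memory_at (redirect f \<nu>) \<pi> i = memory_at \<nu> \<pi> i"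
  by (induction i) (simp_all add: redirect_def)

lemma choice_redirect:
  "choice (redirect f \<nu>) s m = (if choice \<nu> s m \<inter> f s = {} then f s else choice \<nu> s m \<inter> f s)"
  by (simp add: redirect_def)

lemma is_strategy_redirect:
  assumes "is_strategy G (Memoryless f)" and "is_strategy G \<nu>"
  shows "is_strategy (restrict_game G f) (redirect f \<nu>)"
  using assms unfolding is_strategy_def
  by (auto simp: redirect_def avail_restrict_game subset_iff)

lemma runs_from_redirect:
  assumes G: "two_player_game G" and f: "is_strategy G (Memoryless f)" and \<nu>: "is_strategy G \<nu>"
    and sub: "runs_from G \<nu> s \<subseteq> runs_from G (Memoryless f) s"
  shows "runs_from (restrict_game G f) (redirect f \<nu>) s = runs_from G \<nu> s"
proof
  show "runs_from G \<nu> s \<subseteq> runs_from (restrict_game G f) (redirect f \<nu>) s"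
  proof
    fix \<pi> assume \<pi>: "\<pi> \<in> runs_from G \<nu> s"
    \<comment> \<open>Each system move of \<open>\<pi>\<close> lies both in the choice of
      \<open>\<nu>\<close> and in \<open>f\<close>, so the fallback is never taken along
      \<open>\<pi>\<close>.\<close>
    then have "\<pi> \<in> runs_from G (Memoryless f) s" using sub by blast
    with \<pi> show "\<pi> \<in> runs_from (restrict_game G f) (redirect f \<nu>) s"
      unfolding runs_from_restrict_game by (auto simp: runs_from_def choice_redirect)
  qed
next
  show "runs_from (restrict_game G f) (redirect f \<nu>) s \<subseteq> runs_from G \<nu> s"
  proof
    fix \<pi> assume "\<pi> \<in> runs_from (restrict_game G f) (redirect f \<nu>) s"
    then have \<pi>: "\<pi> \<in> runs_from G (redirect f \<nu>) s"
      by (simp add: runs_from_restrict_game)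
    then have run: "is_run G \<pi>" and start: "fst (\<pi> !! 0) = s"
      by (simp_all add: runs_from_def)
    \<comment> \<open>By strong induction the play before \<open>i\<close> follows
      \<open>\<nu>\<close>, so it extends to a run \<open>\<pi>'\<close> of \<open>\<nu>\<close>
      with the same state and memory at \<open>i\<close>. The action of \<open>\<pi>'\<close> at
      \<open>i\<close> is in the choice of \<open>\<nu>\<close> and, by \<open>sub\<close>, in
      \<open>f\<close>. This rules out the fallback at \<open>i\<close>, so the action of
      \<open>\<pi>\<close> is one that \<open>\<nu>\<close> allows.\<close>
    have "snd (\<pi> !! i) \<in> choice \<nu> (fst (\<pi> !! i)) (memory_at \<nu> \<pi> i)"
      if "fst (\<pi> !! i) \<in> sys_states G" for i
      using that
    proof (induction i rule: less_induct)
      case (less i)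
      have states: "fst (\<pi> !! j) \<in> states G"
        and avail: "snd (\<pi> !! j) \<in> avail G (fst (\<pi> !! j))"
        and trans: "fst (\<pi> !! Suc j) \<in> trans G (fst (\<pi> !! j)) (snd (\<pi> !! j))" for j
        using run unfolding is_run_def by blast+
      obtain \<pi>' where \<pi>': "\<pi>' \<in> runs_from G \<nu> s" "fst (\<pi>' !! i) = fst (\<pi> !! i)"
          "memory_at \<nu> \<pi>' i = memory_at \<nu> \<pi> i"
        using finite_play_extends[OF G \<nu> states avail trans less.IH] unfolding start .
      have "snd (\<pi>' !! i) \<in> choice \<nu> (fst (\<pi> !! i)) (memory_at \<nu> \<pi> i)"
        using runs_from_choice[OF \<pi>'(1), of i] \<pi>'(2,3) less.prems by simp
      moreover have "snd (\<pi>' !! i) \<in> f (fst (\<pi> !! i))"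
        using runs_from_choice[OF subsetD[OF sub \<pi>'(1)], of i] \<pi>'(2) less.prems by simp
      ultimately have "choice \<nu> (fst (\<pi> !! i)) (memory_at \<nu> \<pi> i) \<inter> f (fst (\<pi> !! i)) \<noteq> {}"
        by blast
      moreover have "snd (\<pi> !! i) \<in> choice (redirect f \<nu>) (fst (\<pi> !! i)) (memory_at \<nu> \<pi> i)"
        using runs_from_choice[OF \<pi> less.prems] by simp
      ultimately show ?case
        by (simp add: choice_redirect)
    qed
    then show "\<pi> \<in> runs_from G \<nu> s"
      using run start by (simp add: runs_from_def)
  qed
qed

(* The restricted game has the states and actions of G, so mapping a strategy
   of it back to G is the identity. *)
theorem theorem1:
  fixes G :: "('s, 'a, 'p) game"
    and \<phi>0 \<phi>1 :: "'p ltl"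
    and R :: "'s \<Rightarrow> 'a \<Rightarrow> real"
    and \<gamma> :: real
    and \<mu>p :: "'s \<Rightarrow> 'a set"
    and \<mu> :: "('s, 'a) strategy"
  assumes "two_player_game G"
    and "deterministic_game G"
    and "bool_next \<phi>0" and "bool_next \<phi>1"
    and "spec G = And_ltl \<phi>0 (Always_ltl \<phi>1)"
    and "realizable G"
    and "\<And>s a. s \<in> sys_states G \<Longrightarrow> a \<in> sys_actions G \<union> env_actions G \<Longrightarrow> 0 \<le> R s a"
    and "0 \<le> \<gamma>" and "\<gamma> < 1"
    and "maximally_permissive G (Memoryless \<mu>p)"
    and "is_strategy (restrict_game G \<mu>p) \<mu>"
    and "deterministic_strategy (restrict_game G \<mu>p) \<mu>"
    and "\<And>\<nu> s. is_strategy (restrict_game G \<mu>p) \<nu> \<Longrightarrow> s \<in> init_states (restrict_game G \<mu>p) \<Longrightarrow>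
           worst_case_reward (restrict_game G \<mu>p) R \<gamma> \<nu> s
             \<le> worst_case_reward (restrict_game G \<mu>p) R \<gamma> \<mu> s"
  shows "winning_strategy G \<mu> \<and>
         (\<forall>\<nu>. winning_strategy G \<nu> \<longrightarrow>
           (\<forall>s\<in>init_states G. worst_case_reward G R \<gamma> \<nu> s \<le> worst_case_reward G R \<gamma> \<mu> s))"
proof (intro conjI allI impI ballI)
  note G = assms(1) and \<mu> = assms(11) and optimal = assms(13)
  have win: "winning_strategy G (Memoryless \<mu>p)"
    and incl: "\<And>\<nu>. winning_strategy G \<nu> \<Longrightarrow> includes_strategy G (Memoryless \<mu>p) \<nu>"
    using assms(10) by (auto simp: maximally_permissive_def)
  \<comment> \<open>Equal sets of runs give literally the same infimum, so strategies are compared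
    across the two games through their runs alone.\<close>
  have reward: "worst_case_reward (restrict_game G \<mu>p) R \<gamma> \<nu>' s = worst_case_reward G R \<gamma> \<nu> s"
    if "runs_from (restrict_game G \<mu>p) \<nu>' s = runs_from G \<nu> s" for \<nu> \<nu>' s
    unfolding worst_case_reward_restrict_game that by (simp only: worst_case_reward_def)
  have runs: "runs_from (restrict_game G \<mu>p) \<mu> s = runs_from G \<mu> s" for s
    by (rule runs_from_restrict_game_strategy[OF \<mu>])
  have "runs_from G \<mu> s \<subseteq> runs_from G (Memoryless \<mu>p) s" for s
    using runs[of s] unfolding runs_from_restrict_game by (auto simp: runs_from_def)
  then show "winning_strategy G \<mu>"
    using win is_strategy_of_restrict_game[OF \<mu>] unfolding winning_strategy_def by blast
  fix \<nu> s
  assume \<nu>: "winning_strategy G \<nu>" and s: "s \<in> init_states G"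
  have strat: "is_strategy G (Memoryless \<mu>p)" "is_strategy G \<nu>"
    using win \<nu> by (simp_all add: winning_strategy_def)
  \<comment> \<open>Inclusion in the runs of \<open>\<mu>p\<close> is known from initial states
    only, which is where \<open>s\<close> lies.\<close>
  have "runs_from (restrict_game G \<mu>p) (redirect \<mu>p \<nu>) s = runs_from G \<nu> s"
    using runs_from_redirect[OF G strat] incl[OF \<nu>] s by (simp add: includes_strategy_def)
  then have "worst_case_reward G R \<gamma> \<nu> s
      = worst_case_reward (restrict_game G \<mu>p) R \<gamma> (redirect \<mu>p \<nu>) s"
    by (rule reward[symmetric])
  also have "\<dots> \<le> worst_case_reward (restrict_game G \<mu>p) R \<gamma> \<mu> s"
    by (rule optimal[OF is_strategy_redirect[OF strat]]) (simp add: s)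
  also have "\<dots> = worst_case_reward G R \<gamma> \<mu> s"
    by (rule reward[OF runs])
  finally show "worst_case_reward G R \<gamma> \<nu> s \<le> worst_case_reward G R \<gamma> \<mu> s" .
qed

end
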